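(* For every $n\geq 8$, resolving sets do not have the exchange property in the $n$-wheel $W_n$: there exist minimal resolving sets $S,R$ of $W_n$ and $r\in R$ such that for every $s\in S$ the set $(S\setminus\{s\})\cup\{r\}$ is not a minimal resolving set of $W_n$.
   Context: The $n$-wheel $W_n$ is the join of the cycle $C_n$ with $K_1$: an $n$-cycle together with one additional vertex adjacent to every vertex of the cycle. For a connected graph $G$ with shortest-path distance $d$, $W\subseteq V(G)$ is a resolving set if for every two distinct vertices $u,v$ there is $w\in W$ with $d(w,u)\neq d(w,v)$; it is minimal if no proper subset is a resolving set. Resolving sets have the exchange property in $G$ if whenever $S,R$ are minimal resolving sets and $r\in R$, there is $s\in S$ with $(S\setminus\{s\})\cup\{r\}$ a minimal resolving set. *)

theory Defs
  imports
    "Graph_Theory.Digraph_Component"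
    "Graph_Theory.Pair_Digraph"
    "Graph_Theory.Shortest_Path"
begin

text \<open>Graphs are symmetric digraphs, as in the Graph_Theory library: every undirected edge is
  a pair of opposite arcs.\<close>

text \<open>This is the simple cycle only for \<open>n \<ge> 3\<close>.\<close>

definition cycle_graph :: "nat \<Rightarrow> nat pair_pre_digraph" where
  "cycle_graph n = \<lparr> pverts = {..<n},
     parcs = {(i, j). i < n \<and> j < n \<and> (j = Suc i mod n \<or> i = Suc j mod n)} \<rparr>"

definition graph_join ::
  "'a pair_pre_digraph \<Rightarrow> 'b pair_pre_digraph \<Rightarrow> ('a + 'b) pair_pre_digraph" where
  "graph_join G H = \<lparr> pverts = pverts G <+> pverts H,
     parcs = map_prod Inl Inl ` parcs G \<union> map_prod Inr Inr ` parcs H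
       \<union> (Inl ` pverts G) \<times> (Inr ` pverts H) \<union> (Inr ` pverts H) \<times> (Inl ` pverts G) \<rparr>"

definition K1 :: "unit pair_pre_digraph" where
  "K1 = \<lparr> pverts = {()}, parcs = {} \<rparr>"

definition wheel :: "nat \<Rightarrow> (nat + unit) pair_pre_digraph" where
  "wheel n = graph_join (cycle_graph n) K1"

text \<open>With unit weights the cost of a walk is its number of edges, so the infimum is the
  shortest-path distance, and \<open>\<infinity>\<close> between different components.\<close>

definition graph_dist :: "('a, 'b) pre_digraph \<Rightarrow> 'a \<Rightarrow> 'a \<Rightarrow> ereal" where
  "graph_dist G u v = wf_digraph.\<mu> G (\<lambda>_. 1) u v"

definition resolving_set :: "('a, 'b) pre_digraph \<Rightarrow> 'a set \<Rightarrow> bool" where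
  "resolving_set G W \<longleftrightarrow> W \<subseteq> verts G \<and>
     (\<forall>u \<in> verts G. \<forall>v \<in> verts G. u \<noteq> v \<longrightarrow> (\<exists>w \<in> W. graph_dist G w u \<noteq> graph_dist G w v))"

definition minimal_resolving_set :: "('a, 'b) pre_digraph \<Rightarrow> 'a set \<Rightarrow> bool" where
  "minimal_resolving_set G W \<longleftrightarrow> resolving_set G W \<and> (\<forall>W'. W' \<subset> W \<longrightarrow> \<not> resolving_set G W')"

definition resolving_exchange_property :: "('a, 'b) pre_digraph \<Rightarrow> bool" where
  "resolving_exchange_property G \<longleftrightarrow>
     (\<forall>S R. minimal_resolving_set G S \<longrightarrow> minimal_resolving_set G R \<longrightarrow>
        (\<forall>r \<in> R. \<exists>s \<in> S. minimal_resolving_set G ((S - {s}) \<union> {r})))"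

lemma parcs_wheel:
  "parcs (wheel n) =
     {(Inl i, Inl j) | i j. i < n \<and> j < n \<and> (j = Suc i mod n \<or> i = Suc j mod n)}
     \<union> {(Inl i, Inr ()) | i. i < n} \<union> {(Inr (), Inl i) | i. i < n}"
  by (auto simp: wheel_def graph_join_def cycle_graph_def K1_def)

lemma pverts_wheel: "pverts (wheel n) = insert (Inr ()) (Inl ` {..<n})"
  by (auto simp: wheel_def graph_join_def cycle_graph_def K1_def)

lemma pair_graph_wheel:
  assumes "n \<ge> 3"
  shows "pair_graph (wheel n)"
proof -
  have loopfree: "Suc i mod n \<noteq> i" if "i < n" for i
    using that assms by (cases "Suc i = n") auto
  have "finite (pverts (wheel n))"
    by (simp add: pverts_wheel)
  moreover have "parcs (wheel n) \<subseteq> pverts (wheel n) \<times> pverts (wheel n)"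
    by (auto simp: parcs_wheel pverts_wheel)
  ultimately have fin: "finite (parcs (wheel n))"
    by (meson finite_SigmaI finite_subset)
  have "sym (parcs (wheel n))"
    by (auto simp: sym_def parcs_wheel)
  then have sym: "symmetric (with_proj (wheel n))"
    by (simp add: symmetric_def)
  show ?thesis
    using fin sym by unfold_locales (auto simp: parcs_wheel pverts_wheel loopfree dest: loopfree)
qed

lemma connected_wheel:
  assumes "n \<ge> 3"
  shows "Digraph_Component.connected (with_proj (wheel n))"
proof -
  interpret pair_graph "wheel n"
    using assms by (rule pair_graph_wheel)
  have to_hub: "u \<rightarrow>\<^sup>*\<^bsub>with_proj (wheel n)\<^esub> Inr ()" if "u \<in> pverts (wheel n)" for u
    using that by (cases u) (auto simp: pverts_wheel parcs_wheel)
  have from_hub: "Inr () \<rightarrow>\<^sup>*\<^bsub>with_proj (wheel n)\<^esub> u" if "u \<in> pverts (wheel n)" for u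
    using that by (cases u) (auto simp: pverts_wheel parcs_wheel)
  show ?thesis
    unfolding Digraph_Component.connected_def
    by (rule strongly_connectedI)
      (auto simp: pverts_wheel intro!: reachable_mk_symmetricI reachable_trans[OF to_hub from_hub])
qed

end

theory Submission
  imports Defs
begin

text \<open>Two distinct vertices of a cone, such as a wheel, are at distance 1 or 2, so a set of vertices
  resolves it iff the vertices outside the set have pairwise different neighbourhoods in the set.

  If \<open>S\<close> is resolving and \<open>S \<union> {r}\<close> stops resolving whenever an element of \<open>S\<close> is removed, then
  \<open>S\<close> is minimal and \<open>r\<close> cannot be exchanged into it. For \<open>r = 0\<close> the rim vertices \<open>1, 3, 7\<close>,
  followed by those \<open>j\<close> with \<open>7 < j < n - 1\<close> that have the parity of \<open>n\<close>, form such a set unless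
  \<open>n = 9\<close>, where \<open>{1, 3, 6, 8}\<close> does. A minimal resolving set containing \<open>0\<close> exists because
  \<open>{0, 3, 4, \<dots>, n - 2}\<close> is resolving, while without \<open>0\<close> it leaves \<open>0\<close> and \<open>1\<close> without
  neighbours.\<close>

section \<open>Minimal resolving sets and exchange\<close>

lemma resolving_set_mono:
  assumes "resolving_set G A" "A \<subseteq> B" "B \<subseteq> verts G"
  shows "resolving_set G B"
  using assms unfolding resolving_set_def by blast

lemma minimal_resolving_setI:
  assumes "resolving_set G W" "\<And>w. w \<in> W \<Longrightarrow> \<not> resolving_set G (W - {w})"
  shows "minimal_resolving_set G W"
proof -
  have "\<not> resolving_set G W'" if "W' \<subset> W" for W'
  proof
    assume "resolving_set G W'"
    moreover obtain w where "w \<in> W" "W' \<subseteq> W - {w}"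
      using \<open>W' \<subset> W\<close> by blast
    moreover have "W - {w} \<subseteq> verts G"
      using assms(1) by (auto simp: resolving_set_def)
    ultimately show False
      using assms(2) resolving_set_mono by blast
  qed
  with assms(1) show ?thesis
    by (simp add: minimal_resolving_set_def)
qed

lemma obtain_minimal_resolving_set_containing:
  assumes "finite T" "resolving_set G T" "\<not> resolving_set G (T - {r})"
  obtains R where "minimal_resolving_set G R" "r \<in> R"
proof -
  obtain R where R: "R \<subseteq> T" "resolving_set G R"
    and min: "\<And>A. A \<subseteq> T \<Longrightarrow> resolving_set G A \<Longrightarrow> A \<subseteq> R \<Longrightarrow> R = A"
    using finite_has_minimal2[of "{A. A \<subseteq> T \<and> resolving_set G A}" T] assms(1,2) by auto
  have "minimal_resolving_set G R"
    unfolding minimal_resolving_set_def using R min by blast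
  moreover have "r \<in> R"
  proof (rule ccontr)
    assume "r \<notin> R"
    then have "R \<subseteq> T - {r}" "T - {r} \<subseteq> verts G"
      using R(1) assms(2) by (auto simp: resolving_set_def)
    with R(2) assms(3) show False
      using resolving_set_mono by blast
  qed
  ultimately show thesis by (rule that)
qed

lemma not_resolving_exchange_propertyI:
  assumes R: "minimal_resolving_set G R" "r \<in> R"
    and S: "resolving_set G S" "\<And>s. s \<in> S \<Longrightarrow> \<not> resolving_set G (insert r (S - {s}))"
  shows "\<not> resolving_exchange_property G"
proof -
  have "minimal_resolving_set G S"
  proof (rule minimal_resolving_setI)
    fix s assume "s \<in> S"
    have "insert r (S - {s}) \<subseteq> verts G"
      using R S(1) by (auto simp: minimal_resolving_set_def resolving_set_def)
    then show "\<not> resolving_set G (S - {s})"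
      using S(2)[OF \<open>s \<in> S\<close>] resolving_set_mono by blast
  qed fact
  moreover have "\<not> minimal_resolving_set G (S - {s} \<union> {r})" if "s \<in> S" for s
    using S(2)[OF that] by (simp add: minimal_resolving_set_def)
  ultimately show ?thesis
    unfolding resolving_exchange_property_def using R by blast
qed

section \<open>Resolving sets of digraphs of diameter at most two\<close>

definition neighbours_in :: "('a, 'b) pre_digraph \<Rightarrow> 'a set \<Rightarrow> 'a \<Rightarrow> 'a set" where
  "neighbours_in G W v = {w \<in> W. w \<rightarrow>\<^bsub>G\<^esub> v}"

lemma (in wf_digraph) graph_dist_eq_length:
  assumes "awalk u p v" "\<And>q. awalk u q v \<Longrightarrow> length p \<le> length q"
  shows "graph_dist G u v = length p"
  unfolding graph_dist_def \<mu>_def awalk_cost_def using assms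
  by (intro antisym INF_lower2[of p] INF_greatest) (auto simp: sum_list_triv)

lemma (in wf_digraph) graph_dist_diameter_two:
  assumes "u \<in> verts G" "u \<noteq> v \<Longrightarrow> \<not> u \<rightarrow>\<^bsub>G\<^esub> v \<Longrightarrow> \<exists>w. u \<rightarrow>\<^bsub>G\<^esub> w \<and> w \<rightarrow>\<^bsub>G\<^esub> v"
  shows "graph_dist G u v = (if u = v then 0 else if u \<rightarrow>\<^bsub>G\<^esub> v then 1 else 2)"
proof -
  consider "u = v" | "u \<noteq> v" "u \<rightarrow>\<^bsub>G\<^esub> v" | w where "u \<noteq> v" "\<not> u \<rightarrow>\<^bsub>G\<^esub> v" "u \<rightarrow>\<^bsub>G\<^esub> w" "w \<rightarrow>\<^bsub>G\<^esub> v"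
    using assms(2) by blast
  then show ?thesis
  proof cases
    assume "u = v"
    then show ?thesis
      using graph_dist_eq_length[of u "[]" v] assms(1) by (simp add: awalk_Nil_iff zero_ereal_def)
  next
    assume adjacent: "u \<noteq> v" "u \<rightarrow>\<^bsub>G\<^esub> v"
    then obtain e where "e \<in> arcs G" "tail G e = u" "head G e = v"
      by (auto simp: arcs_ends_conv)
    then have "awalk u [e] v"
      by (auto simp: awalk_simps)
    moreover have "length [e] \<le> length q" if "awalk u q v" for q
      using that adjacent(1) by (cases q) (auto simp: awalk_simps)
    ultimately show ?thesis
      using graph_dist_eq_length[of u "[e]" v] adjacent by (simp add: one_ereal_def)
  next
    fix w assume nonadjacent: "u \<noteq> v" "\<not> u \<rightarrow>\<^bsub>G\<^esub> v" and "u \<rightarrow>\<^bsub>G\<^esub> w" "w \<rightarrow>\<^bsub>G\<^esub> v"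
    then obtain e f where "e \<in> arcs G" "tail G e = u" "head G e = w"
        "f \<in> arcs G" "tail G f = w" "head G f = v"
      by (auto simp: arcs_ends_conv)
    then have "awalk u [e, f] v"
      by (auto simp: awalk_simps)
    moreover have "length [e, f] \<le> length q" if "awalk u q v" for q
      using that nonadjacent
      by (cases q rule: remdups_adj.cases) (auto simp: awalk_simps arcs_ends_conv)
    ultimately show ?thesis
      using graph_dist_eq_length[of u "[e, f]" v] nonadjacent by simp
  qed
qed

lemma (in wf_digraph) resolving_set_diameter_two_iff:
  assumes diameter: "\<And>u v. u \<in> verts G \<Longrightarrow> v \<in> verts G \<Longrightarrow> u \<noteq> v \<Longrightarrow> \<not> u \<rightarrow>\<^bsub>G\<^esub> v \<Longrightarrow>
      \<exists>w. u \<rightarrow>\<^bsub>G\<^esub> w \<and> w \<rightarrow>\<^bsub>G\<^esub> v"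
  shows "resolving_set G W \<longleftrightarrow> W \<subseteq> verts G \<and> inj_on (neighbours_in G W) (verts G - W)"
proof (cases "W \<subseteq> verts G")
  case True
  have dist: "graph_dist G w v = (if w = v then 0 else if w \<rightarrow>\<^bsub>G\<^esub> v then 1 else 2)"
    if "w \<in> W" "v \<in> verts G" for w v
    using that True diameter by (intro graph_dist_diameter_two) auto
  have "(\<exists>w\<in>W. graph_dist G w u \<noteq> graph_dist G w v) \<longleftrightarrow>
      u \<in> W \<or> v \<in> W \<or> neighbours_in G W u \<noteq> neighbours_in G W v"
    if "u \<in> verts G" "v \<in> verts G" "u \<noteq> v" for u v
  proof (cases "u \<in> W \<or> v \<in> W")
    case True
    then have "\<exists>w\<in>W. (w = u) \<noteq> (w = v)"
      using \<open>u \<noteq> v\<close> by auto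
    then have "\<exists>w\<in>W. graph_dist G w u \<noteq> graph_dist G w v"
      using that by (auto simp: dist intro!: bexI split: if_splits)
    with True show ?thesis by blast
  next
    case False
    then have "graph_dist G w u \<noteq> graph_dist G w v \<longleftrightarrow> (w \<rightarrow>\<^bsub>G\<^esub> u) \<noteq> (w \<rightarrow>\<^bsub>G\<^esub> v)" if "w \<in> W" for w
      using that \<open>u \<in> verts G\<close> \<open>v \<in> verts G\<close> by (auto simp: dist)
    then show ?thesis
      using False by (auto simp: neighbours_in_def)
  qed
  then show ?thesis
    using True by (auto simp: resolving_set_def inj_on_def)
qed (simp add: resolving_set_def)

section \<open>Cones and wheels\<close>

lemma pair_wf_digraph_cone:
  assumes "pair_wf_digraph G"
  shows "pair_wf_digraph (graph_join G K1)"
  using assms by (auto simp: pair_wf_digraph_def graph_join_def K1_def)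

lemma neighbours_in_cone:
  assumes "W \<subseteq> pverts G"
  shows "neighbours_in (graph_join G K1) (Inl ` W) (Inl v) = Inl ` neighbours_in G W v"
    and "neighbours_in (graph_join G K1) (Inl ` W) (Inr ()) = Inl ` W"
  using assms by (auto simp: neighbours_in_def graph_join_def K1_def)

lemma resolving_set_cone_iff:
  assumes "pair_wf_digraph G"
  shows "resolving_set (graph_join G K1) (Inl ` W) \<longleftrightarrow>
    W \<subseteq> pverts G \<and> inj_on (neighbours_in G W) (pverts G - W) \<and>
    W \<notin> neighbours_in G W ` (pverts G - W)"
proof -
  interpret pair_wf_digraph "graph_join G K1"
    using assms by (rule pair_wf_digraph_cone)
  let ?cone = "with_proj (graph_join G K1)"
  have verts: "pverts (graph_join G K1) = insert (Inr ()) (Inl ` pverts G)"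
    by (auto simp: graph_join_def K1_def)
  have "resolving_set ?cone (Inl ` W) \<longleftrightarrow> Inl ` W \<subseteq> pverts (graph_join G K1) \<and>
      inj_on (neighbours_in ?cone (Inl ` W)) (pverts (graph_join G K1) - Inl ` W)"
    by (rule resolving_set_diameter_two_iff) (auto simp: graph_join_def K1_def)
  also have "pverts (graph_join G K1) - Inl ` W = insert (Inr ()) (Inl ` (pverts G - W))"
    unfolding verts by auto
  also have "Inl ` W \<subseteq> pverts (graph_join G K1) \<longleftrightarrow> W \<subseteq> pverts G"
    unfolding verts by auto
  finally show ?thesis
    by (auto simp: neighbours_in_cone inj_on_def inj_image_eq_iff image_iff eq_commute[of W])
qed

lemma neighbours_in_cycle_graph:
  assumes "v < n"
  shows "neighbours_in (cycle_graph n) W v =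
    W \<inter> {if Suc v = n then 0 else Suc v, if v = 0 then n - 1 else v - 1}"
  using assms by (auto simp: neighbours_in_def cycle_graph_def mod_Suc split: if_splits)

lemma card_neighbours_in_cycle_graph_le:
  assumes "v < n"
  shows "card (neighbours_in (cycle_graph n) W v) \<le> 2"
  unfolding neighbours_in_cycle_graph[OF assms]
  by (rule order_trans[OF card_mono[OF _ Int_lower2]]) (simp_all add: card_insert_if)

lemma resolving_set_wheel_iff:
  "resolving_set (wheel n) (Inl ` W) \<longleftrightarrow>
    W \<subseteq> {..<n} \<and> inj_on (neighbours_in (cycle_graph n) W) ({..<n} - W) \<and>
    W \<notin> neighbours_in (cycle_graph n) W ` ({..<n} - W)"
proof -
  have "pair_wf_digraph (cycle_graph n)"
    by (auto simp: pair_wf_digraph_def cycle_graph_def)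
  from resolving_set_cone_iff[OF this] show ?thesis
    by (simp add: wheel_def cycle_graph_def)
qed

lemma resolving_set_wheelI:
  assumes "W \<subseteq> {..<n}" "card W \<ge> 3" "inj_on (neighbours_in (cycle_graph n) W) ({..<n} - W)"
  shows "resolving_set (wheel n) (Inl ` W)"
proof -
  have "card (neighbours_in (cycle_graph n) W v) < card W" if "v < n" for v
    using card_neighbours_in_cycle_graph_le[OF that, of W] assms(2) by simp
  then show ?thesis
    using assms unfolding resolving_set_wheel_iff by force
qed

lemma not_resolving_set_wheelI:
  assumes "u \<in> {..<n} - W" "v \<in> {..<n} - W" "u \<noteq> v"
    and "neighbours_in (cycle_graph n) W u = neighbours_in (cycle_graph n) W v"
  shows "\<not> resolving_set (wheel n) (Inl ` W)"
  using assms unfolding resolving_set_wheel_iff by (blast dest: inj_onD)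

lemma obtain_minimal_resolving_set_wheel:
  assumes "n \<ge> 6"
  obtains R where "minimal_resolving_set (wheel n) R" "Inl 0 \<in> R"
proof (rule obtain_minimal_resolving_set_containing)
  let ?N = "neighbours_in (cycle_graph n)"
  define T where "T = insert 0 {3..<n - 1}"
  show "finite (Inl ` T :: (nat + unit) set)"
    by (simp add: T_def)
  show "resolving_set (wheel n) (Inl ` T)"
  proof (rule resolving_set_wheelI)
    show "T \<subseteq> {..<n}" "card T \<ge> 3"
      using assms by (auto simp: T_def)
    have "{..<n} - T = {1, 2, n - 1}"
      using assms by (auto simp: T_def)
    moreover have "?N T 1 = {0}" "?N T 2 = {3}" "?N T (n - 1) = {0, n - 2}"
      using assms by (auto simp: neighbours_in_cycle_graph T_def)
    ultimately show "inj_on (?N T) ({..<n} - T)"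
      using assms by auto
  qed
  have "\<not> resolving_set (wheel n) (Inl ` (T - {0}))"
    using assms by (intro not_resolving_set_wheelI[of 0 _ _ 1])
      (auto simp: neighbours_in_cycle_graph T_def)
  then show "\<not> resolving_set (wheel n) (Inl ` T - {Inl 0})"
    by (simp add: image_set_diff)
qed

lemma not_resolving_exchange_property_wheelI:
  assumes "n \<ge> 6" "resolving_set (wheel n) (Inl ` S)"
    and "\<And>s. s \<in> S \<Longrightarrow> \<not> resolving_set (wheel n) (Inl ` insert 0 (S - {s}))"
  shows "\<not> resolving_exchange_property (wheel n)"
proof -
  obtain R where "minimal_resolving_set (wheel n) R" "Inl 0 \<in> R"
    using assms(1) by (rule obtain_minimal_resolving_set_wheel)
  then show ?thesis
    using assms(2)
    by (rule not_resolving_exchange_propertyI) (use assms(3) in \<open>auto simp: image_set_diff\<close>)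
qed

section \<open>Resolving sets without exchange\<close>

lemma not_resolving_exchange_property_wheel_9: "\<not> resolving_exchange_property (wheel 9)"
proof (rule not_resolving_exchange_property_wheelI)
  let ?S = "{1, 3, 6, 8} :: nat set"
  show "resolving_set (wheel 9) (Inl ` ?S)"
  proof (rule resolving_set_wheelI)
    let ?N = "neighbours_in (cycle_graph 9) ?S"
    have "{..<9} - ?S = {0, 2, 4, 5, 7}"
      by auto
    moreover have "?N 0 = {1, 8}" "?N 2 = {1, 3}" "?N 4 = {3}" "?N 5 = {6}" "?N 7 = {6, 8}"
      by (simp_all add: neighbours_in_cycle_graph insert_commute)
    ultimately show "inj_on ?N ({..<9} - ?S)"
      by (simp add: doubleton_eq_iff)
  qed auto
  fix s assume "s \<in> ?S"
  then consider "s = 1" | "s = 3" | "s = 6" | "s = 8"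
    by auto
  then show "\<not> resolving_set (wheel 9) (Inl ` insert 0 (?S - {s}))"
  proof cases
    assume "s = 1"
    then show ?thesis
      by (intro not_resolving_set_wheelI[of 2 _ _ 4]) (auto simp: neighbours_in_cycle_graph)
  next
    assume "s = 3"
    then show ?thesis
      by (intro not_resolving_set_wheelI[of 3 _ _ 4]) (auto simp: neighbours_in_cycle_graph)
  next
    assume "s = 6"
    then show ?thesis
      by (intro not_resolving_set_wheelI[of 5 _ _ 6]) (auto simp: neighbours_in_cycle_graph)
  next
    assume "s = 8"
    then show ?thesis
      by (intro not_resolving_set_wheelI[of 5 _ _ 7]) (auto simp: neighbours_in_cycle_graph)
  qed
qed simp

definition rigid_rim_set :: "nat \<Rightarrow> nat set" where
  "rigid_rim_set n = {1, 3, 7} \<union> {j. 7 < j \<and> j < n - 1 \<and> even (n + j)}"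

lemma pred_in_neighbours_in_rigid_rim_set:
  assumes "v \<ge> 8" "v < n" "v \<notin> rigid_rim_set n"
  shows "v - 1 \<in> neighbours_in (cycle_graph n) (rigid_rim_set n) v"
proof -
  have "v = n - 1 \<or> odd (n + v)"
    using assms by (auto simp: rigid_rim_set_def)
  then have "even (n + (v - 1))"
    using assms(1) by presburger
  then show ?thesis
    using assms(1,2) by (auto simp: neighbours_in_cycle_graph rigid_rim_set_def)
qed

lemma neighbours_in_rigid_rim_set_neq:
  assumes "n \<ge> 8" "n \<noteq> 9" "u < v" "v < n" "u \<notin> rigid_rim_set n" "v \<notin> rigid_rim_set n"
  shows "neighbours_in (cycle_graph n) (rigid_rim_set n) u \<noteq>
    neighbours_in (cycle_graph n) (rigid_rim_set n) v"
    (is "?N u \<noteq> ?N v")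
proof
  assume eq: "?N u = ?N v"
  note N = neighbours_in_cycle_graph rigid_rim_set_def
  consider "v \<le> 6" | "v \<ge> 8"
    using assms(6) by (force simp: rigid_rim_set_def)
  then show False
  proof cases
    assume "v \<le> 6"
    then have "u \<in> {0, 2, 4, 5}" "v \<in> {2, 4, 5, 6}"
      using assms(3,5,6) by (auto simp: rigid_rim_set_def)
    moreover have "1 \<in> ?N u \<longleftrightarrow> 1 \<in> ?N v" "3 \<in> ?N u \<longleftrightarrow> 3 \<in> ?N v" "7 \<in> ?N u \<longleftrightarrow> 7 \<in> ?N v"
      using eq by simp_all
    ultimately show False
      using assms(1,3) by (auto simp: N)
  next
    assume "v \<ge> 8"
    then have "v - 1 \<in> ?N u"
      unfolding eq using assms(4,6) by (rule pred_in_neighbours_in_rigid_rim_set)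
    then have "v = u + 2"
      using assms(3,4) by (auto simp: neighbours_in_cycle_graph split: if_splits)
    then consider "u = 6" "v = 8" | "u \<ge> 8"
      using \<open>v \<ge> 8\<close> assms(5) by (force simp: rigid_rim_set_def)
    then show False
    proof cases
      assume "u = 6" "v = 8"
      then have "odd n" "n > 9"
        using assms(2,4,6) by (auto simp: rigid_rim_set_def)
      then have "n \<ge> 11"
        by presburger
      then have "9 \<in> ?N v" "9 \<notin> ?N u"
        using \<open>odd n\<close> \<open>u = 6\<close> \<open>v = 8\<close> by (auto simp: N)
      with eq show False by simp
    next
      assume "u \<ge> 8"
      then have "u - 1 \<in> ?N u" "u - 1 \<notin> ?N v"
        using assms(4,5) \<open>v = u + 2\<close> by (auto simp: N)
      with eq show False by simp
    qed
  qed
qed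

lemma resolving_set_rigid_rim_set:
  assumes "n \<ge> 8" "n \<noteq> 9"
  shows "resolving_set (wheel n) (Inl ` rigid_rim_set n)"
proof (rule resolving_set_wheelI)
  let ?S = "rigid_rim_set n"
  show "?S \<subseteq> {..<n}"
    using assms(1) by (auto simp: rigid_rim_set_def)
  then have "card {1, 3, 7 :: nat} \<le> card ?S"
    by (intro card_mono finite_subset[OF _ finite_lessThan]) (auto simp: rigid_rim_set_def)
  then show "card ?S \<ge> 3"
    by simp
  show "inj_on (neighbours_in (cycle_graph n) ?S) ({..<n} - ?S)"
    using assms by (intro linorder_inj_onI' neighbours_in_rigid_rim_set_neq) auto
qed

lemma not_resolving_set_exchange_rigid_rim_set:
  assumes "n \<ge> 8" "s \<in> rigid_rim_set n"
  shows "\<not> resolving_set (wheel n) (Inl ` insert 0 (rigid_rim_set n - {s}))"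
proof -
  note N = neighbours_in_cycle_graph rigid_rim_set_def
  consider "s = 1" | "s = 3" | "s = 7" | "s = 8" "n \<ge> 10" "even n"
    | "9 \<le> s" "s < n - 1" "even (n + s)"
    using assms(2) by (cases "s = 8") (auto simp: rigid_rim_set_def)
  then show ?thesis
  proof cases
    assume "s = 1"
    then show ?thesis
      using assms(1) by (intro not_resolving_set_wheelI[of 2 _ _ 4]) (auto simp: N)
  next
    assume "s = 3"
    then show ?thesis
      using assms(1) by (intro not_resolving_set_wheelI[of 3 _ _ 4]) (auto simp: N)
  next
    assume "s = 7"
    then show ?thesis
      using assms(1) by (intro not_resolving_set_wheelI[of 5 _ _ 6]) (auto simp: N)
  next
    assume "s = 8" "n \<ge> 10" "even n"
    then show ?thesis
      by (intro not_resolving_set_wheelI[of 6 _ _ 8]) (auto simp: N)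
  next
    assume "9 \<le> s" "s < n - 1" "even (n + s)"
    then show ?thesis
      by (intro not_resolving_set_wheelI[of 5 _ _ s]) (auto simp: N)
  qed
qed

theorem theorem15:
  fixes n :: nat
  assumes "n \<ge> 8"
  shows "\<not> resolving_exchange_property (with_proj (wheel n))"
proof (cases "n = 9")
  case True
  then show ?thesis
    using not_resolving_exchange_property_wheel_9 by simp
next
  case False
  show ?thesis
  proof (rule not_resolving_exchange_property_wheelI)
    show "resolving_set (wheel n) (Inl ` rigid_rim_set n)"
      using assms False by (rule resolving_set_rigid_rim_set)
    show "\<not> resolving_set (wheel n) (Inl ` insert 0 (rigid_rim_set n - {s}))"
      if "s \<in> rigid_rim_set n" for s
      using assms that by (rule not_resolving_set_exchange_rigid_rim_set)
  qed (use assms in simp)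
qed

end
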